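(* Let $p$ be a prime, $d\ge 2$, and consider on $\mathbb{Q}_p^d$ the deformed metric $\widetilde d(x,y)=\max_{1\le l\le d}\left(q_l|x_l-y_l|_p\right)$ with parameters $q_1<q_2<\dots<q_d$, all $q_i\in(p^{-1},1]$. Then the $d\times d$ matrix $$A=\begin{pmatrix} 0 & 1 & 0 & \dots & 0 \\ 0 & 0 & 1 & \dots & 0 \\ \vdots & & & & \vdots \\ 0 & 0 & \dots & 0 & 1 \\ p & 0 & \dots & 0 & 0 \end{pmatrix},$$ i.e. the linear map $(x_1,\dots,x_d)\mapsto(x_2,\dots,x_d,px_1)$, is a dilation of $\mathbb{Q}_p^d$ with respect to $\widetilde d$.
   Context: A dilation with respect to $\widetilde d$ is a linear map $\mathbb{Q}_p^d\to\mathbb{Q}_p^d$ which maps any $\widetilde d$-ball (of positive radius) with center at zero onto a maximal proper $\widetilde d$-subball with center at zero of this ball. *)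

theory Defs
  imports
    "HOL-Analysis.Abstract_Metric_Spaces"
    "HOL-Computational_Algebra.Squarefree"
    "Jordan_Normal_Form.VS_Connect"
    "Berlekamp_Zassenhaus.Finite_Field"
begin

unbundle no vec_syntax

section \<open>The p-adic absolute value on the rationals\<close>

definition rat_padic_abs :: "nat \<Rightarrow> rat \<Rightarrow> real" where
  "rat_padic_abs p x =
     (if x = 0 then 0
      else case quotient_of x of (a, b) \<Rightarrow>
        real p powi (int (multiplicity (int p) b) - int (multiplicity (int p) a)))"

lemma rat_padic_abs_fract:
  assumes p: "prime p" and a: "a \<noteq> 0" and b: "b \<noteq> 0"
  shows "rat_padic_abs p (of_int a / of_int b) =
    real p powi (int (multiplicity (int p) b) - int (multiplicity (int p) a))"
proof -
  let ?x = "of_int a / of_int b :: rat"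
  obtain a' b' where q: "quotient_of ?x = (a', b')" by (cases "quotient_of ?x")
  have b': "b' > 0" using quotient_of_denom_pos[OF q] .
  have x: "?x = of_int a' / of_int b'" using quotient_of_div[OF q] .
  have x0: "?x \<noteq> 0" using a b by simp
  hence a': "a' \<noteq> 0" using x by auto
  have "of_int (a * b') = (of_int (a' * b) :: rat)"
    using x b b' by (simp add: field_simps)
  hence eq: "a * b' = a' * b" by (simp only: of_int_eq_iff)
  have pe: "prime_elem (int p)" using p by auto
  have "multiplicity (int p) a + multiplicity (int p) b' =
        multiplicity (int p) a' + multiplicity (int p) b"
    using arg_cong[OF eq, of "multiplicity (int p)"] pe a b a' b'
    by (simp add: prime_elem_multiplicity_mult_distrib)
  hence "int (multiplicity (int p) b') - int (multiplicity (int p) a') =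
         int (multiplicity (int p) b) - int (multiplicity (int p) a)" by linarith
  thus ?thesis using x0 q unfolding rat_padic_abs_def by simp
qed

lemma rat_fractE:
  fixes x :: rat
  obtains a b where "x = of_int a / of_int b" "b \<noteq> 0"
proof -
  obtain a b where "quotient_of x = (a, b)" by (cases "quotient_of x")
  thus ?thesis using that quotient_of_div quotient_of_denom_pos by (metis less_irrefl)
qed

lemma rat_padic_abs_0 [simp]: "rat_padic_abs p 0 = 0"
  by (simp add: rat_padic_abs_def)

lemma rat_padic_abs_nonneg [simp]: "rat_padic_abs p x \<ge> 0"
  by (simp add: rat_padic_abs_def split: prod.split)

lemma rat_padic_abs_eq_0_iff: "prime p \<Longrightarrow> rat_padic_abs p x = 0 \<longleftrightarrow> x = 0"
  by (auto simp: rat_padic_abs_def split: prod.split)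

lemma rat_padic_abs_1 [simp]: "rat_padic_abs p 1 = 1"
  by (simp add: rat_padic_abs_def)

lemma rat_padic_abs_p: "prime p \<Longrightarrow> rat_padic_abs p (of_nat p) = 1 / real p"
  using rat_padic_abs_fract[of p "int p" 1] prime_gt_0_nat[of p]
  by (simp add: field_simps power_int_minus)

lemma rat_padic_abs_minus [simp]: "rat_padic_abs p (- x) = rat_padic_abs p x"
  by (auto simp: rat_padic_abs_def rat_uminus_code split: prod.split)

lemma rat_padic_abs_minus_commute: "rat_padic_abs p (x - y) = rat_padic_abs p (y - x)"
  using rat_padic_abs_minus[of p "x - y"] by simp

lemma rat_padic_abs_mult:
  assumes p: "prime p"
  shows "rat_padic_abs p (x * y) = rat_padic_abs p x * rat_padic_abs p y"
proof (cases "x = 0 \<or> y = 0")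
  case False
  obtain a b where x: "x = of_int a / of_int b" "b \<noteq> 0" by (rule rat_fractE)
  obtain c e where y: "y = of_int c / of_int e" "e \<noteq> 0" by (rule rat_fractE)
  have nz: "a \<noteq> 0" "c \<noteq> 0" using False x y by auto
  have pe: "prime_elem (int p)" using p by auto
  have xy: "x * y = of_int (a * c) / of_int (b * e)" using x y by simp
  have p0: "real p \<noteq> 0" using p by auto
  let ?m = "\<lambda>k. int (multiplicity (int p) k)"
  have "rat_padic_abs p (x * y) = real p powi (?m (b * e) - ?m (a * c))"
    unfolding xy using nz x(2) y(2) by (intro rat_padic_abs_fract[OF p]) auto
  also have "?m (b * e) - ?m (a * c) = (?m b - ?m a) + (?m e - ?m c)"
    using nz x(2) y(2) by (simp add: prime_elem_multiplicity_mult_distrib[OF pe])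
  also have "real p powi \<dots> = real p powi (?m b - ?m a) * real p powi (?m e - ?m c)"
    using p0 by (simp add: power_int_add)
  also have "\<dots> = rat_padic_abs p x * rat_padic_abs p y"
    unfolding x(1) y(1) rat_padic_abs_fract[OF p nz(1) x(2)] rat_padic_abs_fract[OF p nz(2) y(2)] ..
  finally show ?thesis .
qed auto

lemma rat_padic_abs_inverse:
  assumes p: "prime p"
  shows "rat_padic_abs p (inverse x) = inverse (rat_padic_abs p x)"
proof (cases "x = 0")
  case False
  have "rat_padic_abs p x * rat_padic_abs p (inverse x) = 1"
    using rat_padic_abs_mult[OF p, of x "inverse x"] False by simp
  thus ?thesis by (metis inverse_unique)
qed simp

lemma rat_padic_abs_add:
  assumes p: "prime p"
  shows "rat_padic_abs p (x + y) \<le> max (rat_padic_abs p x) (rat_padic_abs p y)"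
proof (cases "x = 0 \<or> y = 0 \<or> x + y = 0")
  case True
  thus ?thesis by (auto simp: le_max_iff_disj)
next
  case False
  obtain a b where x: "x = of_int a / of_int b" "b \<noteq> 0" by (rule rat_fractE)
  obtain c e where y: "y = of_int c / of_int e" "e \<noteq> 0" by (rule rat_fractE)
  define A C E where "A = a * e" and "C = c * b" and "E = b * e"
  have E: "E \<noteq> 0" using x y by (simp add: E_def)
  have xA: "x = of_int A / of_int E" and yC: "y = of_int C / of_int E"
    using x y by (simp_all add: A_def C_def E_def)
  have s: "x + y = of_int (A + C) / of_int E" by (simp add: xA yC add_divide_distrib)
  have nz: "A \<noteq> 0" "C \<noteq> 0" "A + C \<noteq> 0" using False xA yC s by auto
  define m where "m = min (multiplicity (int p) A) (multiplicity (int p) C)"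
  have "int p ^ m dvd A + C"
    by (intro dvd_add multiplicity_dvd') (auto simp: m_def)
  moreover have "\<not> is_unit (int p)" using p by auto
  ultimately have "m \<le> multiplicity (int p) (A + C)"
    using nz by (intro multiplicity_geI) auto
  hence "int (multiplicity (int p) A) \<le> int (multiplicity (int p) (A + C)) \<or>
         int (multiplicity (int p) C) \<le> int (multiplicity (int p) (A + C))"
    by (auto simp: m_def min_def split: if_splits)
  moreover have "real p \<ge> 1" using prime_ge_1_nat[OF p] by simp
  ultimately show ?thesis
    unfolding s
    unfolding xA yC rat_padic_abs_fract[OF p nz(1) E] rat_padic_abs_fract[OF p nz(2) E]
      rat_padic_abs_fract[OF p nz(3) E] le_max_iff_disj
    by (elim disj_forward) (intro power_int_increasing; simp)+
qed

lemma rat_padic_abs_diff_le: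
  assumes p: "prime p"
  shows "\<bar>rat_padic_abs p x - rat_padic_abs p y\<bar> \<le> rat_padic_abs p (x - y)"
proof -
  have le: "rat_padic_abs p x \<le> rat_padic_abs p (x - y) + rat_padic_abs p y" for x y
  proof -
    have "rat_padic_abs p x \<le> max (rat_padic_abs p (x - y)) (rat_padic_abs p y)"
      using rat_padic_abs_add[OF p, of "x - y" y] by simp
    also have "\<dots> \<le> rat_padic_abs p (x - y) + rat_padic_abs p y" by simp
    finally show ?thesis .
  qed
  show ?thesis
    using le[of x y] le[of y x] rat_padic_abs_minus_commute[of p x y] by linarith
qed


section \<open>The field of p-adic numbers\<close>

definition padic_Cauchy :: "nat \<Rightarrow> (nat \<Rightarrow> rat) \<Rightarrow> bool" where
  "padic_Cauchy p X \<longleftrightarrow>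
     (\<forall>e>0. \<exists>N. \<forall>m\<ge>N. \<forall>n\<ge>N. rat_padic_abs p (X m - X n) < e)"

definition padic_null :: "nat \<Rightarrow> (nat \<Rightarrow> rat) \<Rightarrow> bool" where
  "padic_null p X \<longleftrightarrow> (\<lambda>n. rat_padic_abs p (X n)) \<longlonglongrightarrow> 0"

definition padic_rel :: "nat \<Rightarrow> (nat \<Rightarrow> rat) \<Rightarrow> (nat \<Rightarrow> rat) \<Rightarrow> bool" where
  "padic_rel p X Y \<longleftrightarrow>
     padic_Cauchy p X \<and> padic_Cauchy p Y \<and> padic_null p (\<lambda>n. X n - Y n)"

lemma padic_null_0 [simp]: "padic_null p (\<lambda>n. 0)"
  by (simp add: padic_null_def)

lemma padic_null_minus: "padic_null p (\<lambda>n. - X n) \<longleftrightarrow> padic_null p X"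
  by (simp add: padic_null_def)

lemma padic_null_add:
  assumes p: "prime p" and X: "padic_null p X" and Y: "padic_null p Y"
  shows "padic_null p (\<lambda>n. X n + Y n)"
  unfolding padic_null_def
proof (rule tendsto_sandwich[where f = "\<lambda>_. 0"])
  show "\<forall>\<^sub>F n in sequentially.
    rat_padic_abs p (X n + Y n) \<le> max (rat_padic_abs p (X n)) (rat_padic_abs p (Y n))"
    by (intro always_eventually allI rat_padic_abs_add[OF p])
  show "(\<lambda>n. max (rat_padic_abs p (X n)) (rat_padic_abs p (Y n))) \<longlonglongrightarrow> 0"
    using tendsto_max[OF X[unfolded padic_null_def] Y[unfolded padic_null_def]] by simp
  show "\<forall>\<^sub>F n in sequentially. 0 \<le> rat_padic_abs p (X n + Y n)" by simp
qed simp

lemma padic_null_diff: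
  assumes "prime p" "padic_null p X" "padic_null p Y"
  shows "padic_null p (\<lambda>n. X n - Y n)"
  using padic_null_add[OF assms(1,2), of "\<lambda>n. - Y n"] assms(3) by (simp add: padic_null_minus)

lemma padic_null_swap:
  "padic_null p (\<lambda>n. X n - Y n) \<Longrightarrow> padic_null p (\<lambda>n. Y n - X n)"
  by (simp add: padic_null_def rat_padic_abs_minus_commute[of p "Y _"])

lemma padic_Cauchy_const [simp]: "padic_Cauchy p (\<lambda>n. c)"
  by (simp add: padic_Cauchy_def)

lemma padic_Cauchy_minus: "padic_Cauchy p X \<Longrightarrow> padic_Cauchy p (\<lambda>n. - X n)"
  by (simp add: padic_Cauchy_def rat_padic_abs_minus_commute[of p "X _" "X _"])

lemma padic_Cauchy_add:
  assumes p: "prime p" and X: "padic_Cauchy p X" and Y: "padic_Cauchy p Y"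
  shows "padic_Cauchy p (\<lambda>n. X n + Y n)"
  unfolding padic_Cauchy_def
proof (intro allI impI)
  fix e :: real assume e: "e > 0"
  obtain N where N: "\<forall>m\<ge>N. \<forall>n\<ge>N. rat_padic_abs p (X m - X n) < e"
    using X e unfolding padic_Cauchy_def by blast
  obtain M where M: "\<forall>m\<ge>M. \<forall>n\<ge>M. rat_padic_abs p (Y m - Y n) < e"
    using Y e unfolding padic_Cauchy_def by blast
  have "rat_padic_abs p (X m + Y m - (X n + Y n)) < e" if "m \<ge> max N M" "n \<ge> max N M" for m n
    using that N M rat_padic_abs_add[OF p, of "X m - X n" "Y m - Y n"]
    by (simp add: algebra_simps) (smt (verit) le_max_iff_disj)
  thus "\<exists>N. \<forall>m\<ge>N. \<forall>n\<ge>N. rat_padic_abs p (X m + Y m - (X n + Y n)) < e" by blast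
qed

lemma padic_Cauchy_real:
  assumes p: "prime p" and X: "padic_Cauchy p X"
  shows "Cauchy (\<lambda>n. rat_padic_abs p (X n))"
proof (rule metric_CauchyI)
  fix e :: real assume "e > 0"
  then obtain N where N: "\<forall>m\<ge>N. \<forall>n\<ge>N. rat_padic_abs p (X m - X n) < e"
    using X unfolding padic_Cauchy_def by blast
  thus "\<exists>M. \<forall>m\<ge>M. \<forall>n\<ge>M. dist (rat_padic_abs p (X m)) (rat_padic_abs p (X n)) < e"
    using rat_padic_abs_diff_le[OF p] by (metis dist_real_def le_less_trans)
qed

lemma padic_Cauchy_bounded:
  assumes p: "prime p" and X: "padic_Cauchy p X"
  obtains B where "B > 0" "\<And>n. rat_padic_abs p (X n) \<le> B"
proof -
  have "Bseq (\<lambda>n. rat_padic_abs p (X n))"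
    using padic_Cauchy_real[OF assms] by (rule Cauchy_Bseq)
  thus ?thesis using that by (auto elim!: BseqE)
qed

lemma padic_null_mult_bounded:
  assumes p: "prime p" and X: "padic_Cauchy p X" and Y: "padic_null p Y"
  shows "padic_null p (\<lambda>n. X n * Y n)"
proof -
  obtain B where B: "B > 0" "\<And>n. rat_padic_abs p (X n) \<le> B"
    using padic_Cauchy_bounded[OF p X] by metis
  have "(\<lambda>n. B * rat_padic_abs p (Y n)) \<longlonglongrightarrow> 0"
    using tendsto_mult_right_zero[OF Y[unfolded padic_null_def]] by simp
  moreover have "\<forall>\<^sub>F n in sequentially. norm (rat_padic_abs p (X n * Y n)) \<le> B * rat_padic_abs p (Y n)"
    using B by (intro always_eventually allI) (simp add: rat_padic_abs_mult[OF p] mult_right_mono)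
  ultimately show ?thesis
    unfolding padic_null_def by (rule Lim_null_comparison[rotated])
qed

lemma padic_Cauchy_mult:
  assumes p: "prime p" and X: "padic_Cauchy p X" and Y: "padic_Cauchy p Y"
  shows "padic_Cauchy p (\<lambda>n. X n * Y n)"
  unfolding padic_Cauchy_def
proof (intro allI impI)
  fix e :: real assume e: "e > 0"
  obtain A where A: "A > 0" "\<And>n. rat_padic_abs p (X n) \<le> A"
    using padic_Cauchy_bounded[OF p X] by metis
  obtain B where B: "B > 0" "\<And>n. rat_padic_abs p (Y n) \<le> B"
    using padic_Cauchy_bounded[OF p Y] by metis
  have eA: "e / A > 0" and eB: "e / B > 0" using e A B by auto
  obtain N where N: "\<forall>m\<ge>N. \<forall>n\<ge>N. rat_padic_abs p (X m - X n) < e / B"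
    using X eB unfolding padic_Cauchy_def by blast
  obtain M where M: "\<forall>m\<ge>M. \<forall>n\<ge>M. rat_padic_abs p (Y m - Y n) < e / A"
    using Y eA unfolding padic_Cauchy_def by blast
  have "rat_padic_abs p (X m * Y m - X n * Y n) < e" if "m \<ge> max N M" "n \<ge> max N M" for m n
  proof -
    have "rat_padic_abs p (X m * (Y m - Y n)) \<le> A * rat_padic_abs p (Y m - Y n)"
      using A by (simp add: rat_padic_abs_mult[OF p] mult_right_mono)
    also have "\<dots> < A * (e / A)" using M that A by (intro mult_strict_left_mono) auto
    finally have 1: "rat_padic_abs p (X m * (Y m - Y n)) < e" using A by simp
    have "rat_padic_abs p (Y n * (X m - X n)) \<le> B * rat_padic_abs p (X m - X n)"
      using B by (simp add: rat_padic_abs_mult[OF p] mult_right_mono)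
    also have "\<dots> < B * (e / B)" using N that B by (intro mult_strict_left_mono) auto
    finally have 2: "rat_padic_abs p (Y n * (X m - X n)) < e" using B by simp
    have "X m * Y m - X n * Y n = X m * (Y m - Y n) + Y n * (X m - X n)"
      by (simp add: algebra_simps)
    thus ?thesis
      using rat_padic_abs_add[OF p, of "X m * (Y m - Y n)" "Y n * (X m - X n)"] 1 2 by simp
  qed
  thus "\<exists>N. \<forall>m\<ge>N. \<forall>n\<ge>N. rat_padic_abs p (X m * Y m - X n * Y n) < e" by blast
qed

lemma padic_not_null_bound:
  assumes p: "prime p" and X: "padic_Cauchy p X" and nn: "\<not> padic_null p X"
  obtains b N where "b > 0" "\<And>n. n \<ge> N \<Longrightarrow> rat_padic_abs p (X n) > b"
proof -
  obtain L where L: "(\<lambda>n. rat_padic_abs p (X n)) \<longlonglongrightarrow> L"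
    using padic_Cauchy_real[OF p X] Cauchy_convergent convergent_def by blast
  have "L \<ge> 0" by (rule LIMSEQ_le_const[OF L]) auto
  moreover have "L \<noteq> 0" using L nn unfolding padic_null_def by auto
  ultimately have L0: "L > 0" by simp
  hence "\<forall>\<^sub>F n in sequentially. rat_padic_abs p (X n) > L / 2"
    by (intro order_tendstoD(1)[OF L]) auto
  thus ?thesis using that[of "L / 2"] L0 unfolding eventually_sequentially by auto
qed

lemma padic_Cauchy_inverse:
  assumes p: "prime p" and X: "padic_Cauchy p X" and nn: "\<not> padic_null p X"
  shows "padic_Cauchy p (\<lambda>n. inverse (X n))"
  unfolding padic_Cauchy_def
proof (intro allI impI)
  fix e :: real assume e: "e > 0"
  obtain b K where b: "b > 0" "\<And>n. n \<ge> K \<Longrightarrow> rat_padic_abs p (X n) > b"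
    using padic_not_null_bound[OF assms] by metis
  have "e * (b * b) > 0" using e b by simp
  then obtain N where N: "\<forall>m\<ge>N. \<forall>n\<ge>N. rat_padic_abs p (X m - X n) < e * (b * b)"
    using X unfolding padic_Cauchy_def by blast
  have "rat_padic_abs p (inverse (X m) - inverse (X n)) < e" if "m \<ge> max N K" "n \<ge> max N K" for m n
  proof -
    have bm: "rat_padic_abs p (X m) > b" and bn: "rat_padic_abs p (X n) > b" using b that by auto
    hence nz: "X m \<noteq> 0" "X n \<noteq> 0" using b by auto
    have "inverse (X m) - inverse (X n) = (X n - X m) * inverse (X m * X n)"
      using nz by (simp add: field_simps)
    hence eq: "rat_padic_abs p (inverse (X m) - inverse (X n)) =
      rat_padic_abs p (X n - X m) / (rat_padic_abs p (X m) * rat_padic_abs p (X n))"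
      by (simp add: rat_padic_abs_mult[OF p] rat_padic_abs_inverse[OF p] divide_inverse)
    have bb: "b * b < rat_padic_abs p (X m) * rat_padic_abs p (X n)"
      using bm bn b by (intro mult_strict_mono) auto
    have "rat_padic_abs p (X n - X m) < e * (b * b)" using N that by auto
    also have "\<dots> < e * (rat_padic_abs p (X m) * rat_padic_abs p (X n))"
      using bb e by (intro mult_strict_left_mono)
    finally show ?thesis
      unfolding eq using bm bn b by (subst pos_divide_less_eq) auto
  qed
  thus "\<exists>N. \<forall>m\<ge>N. \<forall>n\<ge>N. rat_padic_abs p (inverse (X m) - inverse (X n)) < e" by blast
qed

lemma padic_null_inverse_diff:
  assumes p: "prime p" and X: "padic_Cauchy p X" "\<not> padic_null p X"
    and Y: "padic_Cauchy p Y" "\<not> padic_null p Y" and XY: "padic_null p (\<lambda>n. X n - Y n)"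
  shows "padic_null p (\<lambda>n. inverse (X n) - inverse (Y n))"
proof -
  obtain b K where b: "b > 0" "\<And>n. n \<ge> K \<Longrightarrow> rat_padic_abs p (X n) > b"
    using padic_not_null_bound[OF p X] by metis
  obtain c M where c: "c > 0" "\<And>n. n \<ge> M \<Longrightarrow> rat_padic_abs p (Y n) > c"
    using padic_not_null_bound[OF p Y] by metis
  have "padic_null p (\<lambda>n. inverse (X n) * inverse (Y n) * (Y n - X n))"
    using padic_null_swap[OF XY] padic_Cauchy_inverse[OF p X] padic_Cauchy_inverse[OF p Y]
    by (intro padic_null_mult_bounded padic_Cauchy_mult p)
  moreover have "\<forall>\<^sub>F n in sequentially.
    rat_padic_abs p (inverse (X n) * inverse (Y n) * (Y n - X n)) =
    rat_padic_abs p (inverse (X n) - inverse (Y n))"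
    unfolding eventually_sequentially
  proof (intro exI allI impI)
    fix n assume n: "n \<ge> max K M"
    hence "X n \<noteq> 0" "Y n \<noteq> 0" using b(2)[of n] c(2)[of n] b(1) c(1) by auto
    hence "inverse (X n) * inverse (Y n) * (Y n - X n) = inverse (X n) - inverse (Y n)"
      by (simp add: field_simps)
    thus "rat_padic_abs p (inverse (X n) * inverse (Y n) * (Y n - X n)) =
      rat_padic_abs p (inverse (X n) - inverse (Y n))" by simp
  qed
  ultimately show ?thesis
    unfolding padic_null_def by (rule Lim_transform_eventually)
qed

lemma padic_rel_refl: "padic_Cauchy p X \<Longrightarrow> padic_rel p X X"
  by (simp add: padic_rel_def)

lemma padic_rel_null_iff:
  assumes p: "prime p" and XY: "padic_null p (\<lambda>n. X n - Y n)"
  shows "padic_null p X \<longleftrightarrow> padic_null p Y"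
  using padic_null_diff[OF p _ XY, of X] padic_null_add[OF p _ XY, of Y] by auto

lemma part_equivp_padic_rel: "prime p \<Longrightarrow> part_equivp (padic_rel p)"
proof (rule part_equivpI)
  assume p: "prime p"
  show "\<exists>X. padic_rel p X X" using padic_rel_refl[OF padic_Cauchy_const] by blast
  show "symp (padic_rel p)"
    unfolding padic_rel_def by (intro sympI) (auto intro: padic_null_swap)
  show "transp (padic_rel p)"
  proof (rule transpI)
    fix X Y Z assume "padic_rel p X Y" "padic_rel p Y Z"
    thus "padic_rel p X Z"
      using padic_null_add[OF p, of "\<lambda>n. X n - Y n" "\<lambda>n. Y n - Z n"] by (auto simp: padic_rel_def)
  qed
qed

text \<open>
  The completion of the rationals with respect to the p-adic absolute value: Cauchy sequences
  modulo null sequences. The prime is carried by the phantom type parameter, \<open>p = CARD('a)\<close>, so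
  that the p-adic numbers form an instance of the class of fields for every prime p.
\<close>

typedef (overloaded) 'a padic =
  "{C. \<exists>X. padic_rel CARD('a::prime_card) X X \<and> C = Collect (padic_rel CARD('a) X)}"
  using padic_rel_refl[OF padic_Cauchy_const] by blast

definition padic_of_seq :: "(nat \<Rightarrow> rat) \<Rightarrow> 'a::prime_card padic" where
  "padic_of_seq X = quot_type.abs (padic_rel CARD('a)) Abs_padic X"

definition rep_seq :: "'a::prime_card padic \<Rightarrow> nat \<Rightarrow> rat" where
  "rep_seq x = quot_type.rep Rep_padic x"

definition cr_padic :: "(nat \<Rightarrow> rat) \<Rightarrow> 'a::prime_card padic \<Rightarrow> bool" where
  "cr_padic X x \<longleftrightarrow> padic_rel CARD('a) X X \<and> padic_of_seq X = x"

lemma Quotient_padic: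
  "Quotient (padic_rel CARD('a)) padic_of_seq rep_seq
    (cr_padic :: _ \<Rightarrow> 'a::prime_card padic \<Rightarrow> bool)"
proof -
  interpret quot_type "padic_rel CARD('a)" "Abs_padic :: _ \<Rightarrow> 'a padic" Rep_padic
  proof
    show "part_equivp (padic_rel CARD('a))" by (rule part_equivp_padic_rel[OF prime_card])
    fix x y :: "'a padic" and C
    show "\<exists>X. padic_rel CARD('a) X X \<and> Rep_padic x = Collect (padic_rel CARD('a) X)"
      using Rep_padic[of x] by simp
    show "Abs_padic (Rep_padic x) = x" by (rule Rep_padic_inverse)
    show "(Rep_padic x = Rep_padic y) = (x = y)" by (rule Rep_padic_inject)
    assume "\<exists>X. padic_rel CARD('a) X X \<and> C = Collect (padic_rel CARD('a) X)"
    thus "Rep_padic (Abs_padic C :: 'a padic) = C" by (intro Abs_padic_inverse) simp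
  qed
  have "Quotient3 (padic_rel CARD('a)) (padic_of_seq :: _ \<Rightarrow> 'a padic) rep_seq"
    using Quotient unfolding padic_of_seq_def[abs_def] rep_seq_def[abs_def] .
  thus ?thesis
    by (rule Quotient3_to_Quotient) (auto simp: fun_eq_iff cr_padic_def intro!: eq_reflection)
qed

setup_lifting Quotient_padic

instantiation padic :: (prime_card) field
begin

lift_definition zero_padic :: "'a padic" is "\<lambda>n. 0"
  by (simp add: padic_rel_refl)

lift_definition one_padic :: "'a padic" is "\<lambda>n. 1"
  by (simp add: padic_rel_refl)

lift_definition plus_padic :: "'a padic \<Rightarrow> 'a padic \<Rightarrow> 'a padic" is "\<lambda>X Y n. X n + Y n"
  unfolding padic_rel_def add_diff_add
  using prime_card[where 'a = 'a] by (auto intro: padic_Cauchy_add padic_null_add)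

lift_definition uminus_padic :: "'a padic \<Rightarrow> 'a padic" is "\<lambda>X n. - X n"
  unfolding padic_rel_def minus_diff_minus padic_null_minus
  by (blast intro: padic_Cauchy_minus)

lift_definition times_padic :: "'a padic \<Rightarrow> 'a padic \<Rightarrow> 'a padic" is "\<lambda>X Y n. X n * Y n"
proof -
  fix X X' Y Y' :: "nat \<Rightarrow> rat"
  have p: "prime CARD('a)" by (rule prime_card)
  assume XX': "padic_rel CARD('a) X X'" and YY': "padic_rel CARD('a) Y Y'"
  have "padic_null CARD('a) (\<lambda>n. X n * (Y n - Y' n) + Y' n * (X n - X' n))"
    using XX' YY' by (intro padic_null_add padic_null_mult_bounded p) (auto simp: padic_rel_def)
  moreover have "(\<lambda>n. X n * (Y n - Y' n) + Y' n * (X n - X' n)) = (\<lambda>n. X n * Y n - X' n * Y' n)"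
    by (auto simp: algebra_simps)
  ultimately show "padic_rel CARD('a) (\<lambda>n. X n * Y n) (\<lambda>n. X' n * Y' n)"
    using XX' YY' padic_Cauchy_mult[OF p] by (simp add: padic_rel_def)
qed

lift_definition inverse_padic :: "'a padic \<Rightarrow> 'a padic"
  is "\<lambda>X. if padic_null CARD('a) X then (\<lambda>n. 0) else (\<lambda>n. inverse (X n))"
proof -
  fix X Y :: "nat \<Rightarrow> rat"
  have p: "prime CARD('a)" by (rule prime_card)
  assume XY: "padic_rel CARD('a) X Y"
  hence X: "padic_Cauchy CARD('a) X" and Y: "padic_Cauchy CARD('a) Y"
    and d: "padic_null CARD('a) (\<lambda>n. X n - Y n)"
    by (simp_all add: padic_rel_def)
  show "?thesis X Y"
  proof (cases "padic_null CARD('a) X")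
    case True
    thus ?thesis using padic_rel_null_iff[OF p d] by (simp add: padic_rel_refl)
  next
    case False
    moreover from this have nY: "\<not> padic_null CARD('a) Y" using padic_rel_null_iff[OF p d] by simp
    ultimately have "padic_rel CARD('a) (\<lambda>n. inverse (X n)) (\<lambda>n. inverse (Y n))"
      using padic_Cauchy_inverse[OF p X] padic_Cauchy_inverse[OF p Y]
        padic_null_inverse_diff[OF p X _ Y _ d]
      unfolding padic_rel_def by blast
    thus ?thesis using False nY by simp
  qed
qed

definition "x - y = x + - y" for x y :: "'a padic"

definition "x div y = x * inverse y" for x y :: "'a padic"

instance
proof
  fix a b c :: "'a padic"
  note C = padic_Cauchy_add[OF prime_card[where 'a = 'a]]
    padic_Cauchy_mult[OF prime_card[where 'a = 'a]] padic_Cauchy_minus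
  show "a + b = b + a"
    by transfer (simp add: ac_simps padic_rel_def C)
  show "(a + b) + c = a + (b + c)"
    by transfer (simp add: ac_simps padic_rel_def C)
  show "0 + a = a"
    by transfer (simp add: padic_rel_def)
  show "- a + a = 0"
    by transfer (simp add: padic_rel_def)
  show "a - b = a + - b"
    by (rule minus_padic_def)
  show "(a * b) * c = a * (b * c)"
    by transfer (simp add: ac_simps padic_rel_def C)
  show "a * b = b * a"
    by transfer (simp add: ac_simps padic_rel_def C)
  show "1 * a = a"
    by transfer (simp add: padic_rel_def)
  show "(a + b) * c = a * c + b * c"
    by transfer (simp add: distrib_right padic_rel_def C)
  show "(0 :: 'a padic) \<noteq> 1"
    by transfer (simp add: padic_rel_def padic_null_def tendsto_const_iff)
  show "a div b = a * inverse b"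
    by (rule divide_padic_def)
  show "inverse (0 :: 'a padic) = 0"
    by transfer (simp add: padic_rel_def)
  have "padic_null CARD('a) (\<lambda>n. inverse (X n) * X n - 1)"
    if X: "padic_Cauchy CARD('a) X" "\<not> padic_null CARD('a) X" for X
  proof -
    obtain b N where b: "b > 0" "\<And>n. n \<ge> N \<Longrightarrow> rat_padic_abs CARD('a) (X n) > b"
      using padic_not_null_bound[OF prime_card X] by metis
    have "\<forall>\<^sub>F n in sequentially. rat_padic_abs CARD('a) (inverse (X n) * X n - 1) = 0"
      unfolding eventually_sequentially
    proof (intro exI allI impI)
      fix n assume "n \<ge> N"
      hence "X n \<noteq> 0" using b(2)[of n] b(1) by auto
      thus "rat_padic_abs CARD('a) (inverse (X n) * X n - 1) = 0" by simp
    qed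
    thus ?thesis unfolding padic_null_def by (rule tendsto_eventually)
  qed
  thus "a \<noteq> 0 \<Longrightarrow> inverse a * a = 1"
    by transfer (auto simp: padic_rel_def C padic_Cauchy_inverse[OF prime_card])
qed

end

lift_definition padic_abs :: "'p::prime_card padic \<Rightarrow> real"
  is "\<lambda>X. lim (\<lambda>n. rat_padic_abs CARD('p) (X n))"
proof -
  fix X Y :: "nat \<Rightarrow> rat"
  have p: "prime CARD('p)" by (rule prime_card)
  assume XY: "padic_rel CARD('p) X Y"
  obtain L where L: "(\<lambda>n. rat_padic_abs CARD('p) (X n)) \<longlonglongrightarrow> L"
    using Cauchy_convergent[OF padic_Cauchy_real[OF p, of X]] XY
    by (auto simp: padic_rel_def convergent_def)
  have "(\<lambda>n. rat_padic_abs CARD('p) (X n) - rat_padic_abs CARD('p) (Y n)) \<longlonglongrightarrow> 0"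
  proof (rule Lim_null_comparison)
    show "\<forall>\<^sub>F n in sequentially.
      norm (rat_padic_abs CARD('p) (X n) - rat_padic_abs CARD('p) (Y n)) \<le>
      rat_padic_abs CARD('p) (X n - Y n)"
      using rat_padic_abs_diff_le[OF p] by simp
    show "(\<lambda>n. rat_padic_abs CARD('p) (X n - Y n)) \<longlonglongrightarrow> 0"
      using XY by (simp add: padic_rel_def padic_null_def)
  qed
  from tendsto_diff[OF L this] have "(\<lambda>n. rat_padic_abs CARD('p) (Y n)) \<longlonglongrightarrow> L" by simp
  with L show "lim (\<lambda>n. rat_padic_abs CARD('p) (X n)) = lim (\<lambda>n. rat_padic_abs CARD('p) (Y n))"
    by (simp add: limI)
qed

lemma rat_padic_abs_LIMSEQ:
  "prime p \<Longrightarrow> padic_Cauchy p X \<Longrightarrow>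
    (\<lambda>n. rat_padic_abs p (X n)) \<longlonglongrightarrow> lim (\<lambda>n. rat_padic_abs p (X n))"
  using Cauchy_convergent[OF padic_Cauchy_real] by (simp add: convergent_LIMSEQ_iff)

lemma padic_abs_nonneg [simp]: "padic_abs x \<ge> 0"
proof (transfer, goal_cases)
  case (1 X)
  thus ?case
    by (intro LIMSEQ_le_const[OF rat_padic_abs_LIMSEQ[OF prime_card]]) (auto simp: padic_rel_def)
qed

lemma padic_abs_eq_0_iff: "padic_abs x = 0 \<longleftrightarrow> x = 0"
proof (transfer, goal_cases)
  case (1 X)
  hence "(\<lambda>n. rat_padic_abs CARD('a) (X n)) \<longlonglongrightarrow> lim (\<lambda>n. rat_padic_abs CARD('a) (X n))"
    by (intro rat_padic_abs_LIMSEQ[OF prime_card]) (auto simp: padic_rel_def)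
  thus ?case using 1 by (auto simp: padic_rel_def padic_null_def intro: limI)
qed

lemma padic_abs_mult: "padic_abs (x * y) = padic_abs x * padic_abs y"
proof (transfer, goal_cases)
  case (1 X Y)
  note L = rat_padic_abs_LIMSEQ[OF prime_card[where 'a = 'a]]
  have "(\<lambda>n. rat_padic_abs CARD('a) (X n * Y n)) \<longlonglongrightarrow>
    lim (\<lambda>n. rat_padic_abs CARD('a) (X n)) * lim (\<lambda>n. rat_padic_abs CARD('a) (Y n))"
    unfolding rat_padic_abs_mult[OF prime_card]
    using 1 by (intro tendsto_mult L) (auto simp: padic_rel_def)
  thus ?case by (rule limI)
qed

lemma padic_abs_add: "padic_abs (x + y) \<le> max (padic_abs x) (padic_abs y)"
proof (transfer, goal_cases)
  case (1 X Y)
  note L = rat_padic_abs_LIMSEQ[OF prime_card[where 'a = 'a]]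
  have X: "padic_Cauchy CARD('a) X" and Y: "padic_Cauchy CARD('a) Y"
    using 1 by (auto simp: padic_rel_def)
  show ?case
    by (rule LIMSEQ_le[OF L[OF padic_Cauchy_add[OF prime_card X Y]] tendsto_max[OF L[OF X] L[OF Y]]])
      (use rat_padic_abs_add[OF prime_card[where 'a = 'a]] in auto)
qed

lemma padic_abs_minus_commute: "padic_abs (x - y) = padic_abs (y - x)"
proof -
  have "padic_abs (- z) = padic_abs z" for z :: "'a padic" by transfer simp
  from this[of "x - y"] show ?thesis by simp
qed

lemma padic_abs_of_nat_prime: "padic_abs (of_nat CARD('p) :: 'p::prime_card padic) = 1 / real CARD('p)"
proof -
  have plus: "pcr_padic (\<lambda>n. X n + Y n) (x + y)" if "pcr_padic X x" "pcr_padic Y y"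
    for X Y and x y :: "'p padic"
    using plus_padic.transfer[where 'a = 'p] that unfolding rel_fun_def by blast
  have abs: "padic_abs x = lim (\<lambda>n. rat_padic_abs CARD('p) (X n))" if "pcr_padic X x"
    for X and x :: "'p padic"
    using padic_abs.transfer[where 'p = 'p] that unfolding rel_fun_def by auto
  have one: "pcr_padic (\<lambda>n. 1) (1 :: 'p padic)" by (rule one_padic.transfer)
  have *: "pcr_padic (\<lambda>n. of_nat k) (of_nat k :: 'p padic)" for k
  proof (induction k)
    case 0
    show ?case using zero_padic.transfer[where 'a = 'p] by simp
  next
    case (Suc k)
    show ?case using plus[OF one Suc] by simp
  qed
  have "padic_abs (of_nat CARD('p) :: 'p padic) = lim (\<lambda>n. rat_padic_abs CARD('p) (of_nat CARD('p)))"
    by (rule abs[OF *])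
  also have "\<dots> = 1 / real CARD('p)"
    by (simp only: rat_padic_abs_p[OF prime_card] lim_const)
  finally show ?thesis .
qed


section \<open>The deformed metric and its dilations\<close>

text \<open>Coordinates, and the parameters \<open>q\<close>, are indexed by \<open>0, \<dots>, d - 1\<close>, as usual for \<^typ>\<open>'a vec\<close>.\<close>

definition deformed_dist :: "nat \<Rightarrow> (nat \<Rightarrow> real) \<Rightarrow> 'p::prime_card padic vec \<Rightarrow> 'p padic vec \<Rightarrow> real" where
  "deformed_dist d q x y = Max ((\<lambda>l. q l * padic_abs (x $ l - y $ l)) ` {..<d})"

lemma Metric_space_deformed_dist:
  assumes d: "d > 0" and q: "\<And>l. l < d \<Longrightarrow> q l > 0"
  shows "Metric_space (carrier_vec d) (deformed_dist d q)"
proof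
  have ne: "{..<d} \<noteq> {}" using d by auto
  have ge: "q l * padic_abs (x $ l - y $ l) \<le> deformed_dist d q x y" if "l < d" for x y l
    unfolding deformed_dist_def using that by (intro Max_ge) auto
  have le: "deformed_dist d q x y \<le> r \<longleftrightarrow> (\<forall>l<d. q l * padic_abs (x $ l - y $ l) \<le> r)" for x y r
    unfolding deformed_dist_def using ne by (subst Max_le_iff) auto
  fix x y z :: "'a padic vec"
  show nonneg: "deformed_dist d q x y \<ge> 0" for x y :: "'a padic vec"
    by (rule order_trans[OF _ ge[OF d]]) (use q[OF d] in simp)
  show "deformed_dist d q x y = deformed_dist d q y x"
    by (simp add: deformed_dist_def padic_abs_minus_commute[of "x $ _"])
  {
    assume x: "x \<in> carrier_vec d" and y: "y \<in> carrier_vec d"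
    have "deformed_dist d q x y = 0 \<longleftrightarrow> deformed_dist d q x y \<le> 0" using nonneg[of x y] by linarith
    also have "\<dots> \<longleftrightarrow> (\<forall>l<d. padic_abs (x $ l - y $ l) = 0)"
      unfolding le
    proof (intro all_cong)
      fix l assume "l < d"
      thus "q l * padic_abs (x $ l - y $ l) \<le> 0 \<longleftrightarrow> padic_abs (x $ l - y $ l) = 0"
        using q[of l] order.antisym[OF _ padic_abs_nonneg] by (auto simp: mult_le_0_iff)
    qed
    also have "\<dots> \<longleftrightarrow> x = y" using x y by (auto simp: padic_abs_eq_0_iff)
    finally show "deformed_dist d q x y = 0 \<longleftrightarrow> x = y" .
  }
  have "q l * padic_abs (x $ l - z $ l) \<le> deformed_dist d q x y + deformed_dist d q y z" if l: "l < d" for l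
  proof -
    have "padic_abs (x $ l - z $ l) \<le> max (padic_abs (x $ l - y $ l)) (padic_abs (y $ l - z $ l))"
      using padic_abs_add[of "x $ l - y $ l" "y $ l - z $ l"] by simp
    also have "\<dots> \<le> padic_abs (x $ l - y $ l) + padic_abs (y $ l - z $ l)"
      by simp
    finally have "q l * padic_abs (x $ l - z $ l) \<le>
      q l * padic_abs (x $ l - y $ l) + q l * padic_abs (y $ l - z $ l)"
      using q[OF l] by (simp flip: distrib_left)
    thus ?thesis using ge[OF l, of x y] ge[OF l, of y z] by linarith
  qed
  thus "deformed_dist d q x z \<le> deformed_dist d q x y + deformed_dist d q y z" unfolding le by blast
qed

text \<open>
  Balls are closed balls. As the distance takes values in a set that is discrete away from 0, the
  open balls of positive radius are the same sets. A subball may be any ball, also a single point;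
  two balls with a common point are nested and share their centers, so that requiring \<open>D\<close> below
  to be centered at zero as well would not change the notion of dilation.
\<close>

abbreviation deformed_ball ::
  "nat \<Rightarrow> (nat \<Rightarrow> real) \<Rightarrow> 'p::prime_card padic vec \<Rightarrow> real \<Rightarrow> 'p padic vec set" where
  "deformed_ball d q \<equiv> Metric_space.mcball (carrier_vec d) (deformed_dist d q)"

definition is_deformed_ball :: "nat \<Rightarrow> (nat \<Rightarrow> real) \<Rightarrow> 'p::prime_card padic vec set \<Rightarrow> bool" where
  "is_deformed_ball d q B \<longleftrightarrow> (\<exists>c\<in>carrier_vec d. \<exists>r\<ge>0. B = deformed_ball d q c r)"

definition maximal_proper_subball ::
  "nat \<Rightarrow> (nat \<Rightarrow> real) \<Rightarrow> 'p::prime_card padic vec set \<Rightarrow> 'p padic vec set \<Rightarrow> bool" where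
  "maximal_proper_subball d q B C \<longleftrightarrow>
     is_deformed_ball d q C \<and> C \<subset> B \<and>
     \<not> (\<exists>D. is_deformed_ball d q D \<and> C \<subset> D \<and> D \<subset> B)"

definition is_dilation ::
  "nat \<Rightarrow> (nat \<Rightarrow> real) \<Rightarrow> ('p::prime_card padic vec \<Rightarrow> 'p padic vec) \<Rightarrow> bool" where
  "is_dilation d q f \<longleftrightarrow>
     linear_map class_ring (module_vec TYPE('p padic) d) (module_vec TYPE('p padic) d) f \<and>
     (\<forall>r>0. maximal_proper_subball d q (deformed_ball d q (0\<^sub>v d) r) (f ` deformed_ball d q (0\<^sub>v d) r) \<and>
        (\<exists>s\<ge>0. f ` deformed_ball d q (0\<^sub>v d) r = deformed_ball d q (0\<^sub>v d) s))"

definition shift_mat :: "nat \<Rightarrow> 'p::prime_card padic mat" where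
  "shift_mat d = mat d d (\<lambda>(i, j).
     if j = i + 1 then 1 else if i = d - 1 \<and> j = 0 then of_nat CARD('p) else 0)"

lemma shift_mat_mult_vec:
  assumes d: "d \<ge> 2" and x: "x \<in> carrier_vec d"
  shows "shift_mat d *\<^sub>v x =
    vec d (\<lambda>i. if i < d - 1 then x $ (i + 1) else of_nat CARD('p) * x $ 0 :: 'p::prime_card padic)"
proof (rule eq_vecI)
  fix i assume "i < dim_vec (vec d (\<lambda>i. if i < d - 1 then x $ (i + 1) else of_nat CARD('p) * x $ 0))"
  hence i: "i < d" by simp
  have dx: "dim_vec x = d" using x by simp
  have Si: "i < d - Suc 0 \<Longrightarrow> Suc i < d" by arith
  let ?k = "if i < d - 1 then i + 1 else 0"
  have "(shift_mat d *\<^sub>v x) $ i = (\<Sum>j<d. shift_mat d $$ (i, j) * x $ j)"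
    using i x by (simp add: shift_mat_def scalar_prod_def lessThan_atLeast0 dx)
  also have "\<dots> = (\<Sum>j<d. if j = ?k then shift_mat d $$ (i, ?k) * x $ ?k else 0)"
    using i d by (intro sum.cong refl) (auto simp: shift_mat_def less_diff_conv)
  also have "\<dots> = shift_mat d $$ (i, ?k) * x $ ?k" using d Si by simp
  also have "\<dots> = vec d (\<lambda>i. if i < d - 1 then x $ (i + 1) else of_nat CARD('p) * x $ 0) $ i"
    using i d Si by (auto simp: shift_mat_def)
  finally show "(shift_mat d *\<^sub>v x) $ i =
    vec d (\<lambda>i. if i < d - 1 then x $ (i + 1) else of_nat CARD('p) * x $ 0) $ i" .
qed (simp add: shift_mat_def)

end

theory Submission
  imports Defs
begin

text \<open>
  The values of \<open>padic_abs\<close> are \<open>0\<close> and the integral powers of \<open>p\<close>. As all \<open>q l\<close> lie in the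
  interval from \<open>1 / p\<close> (exclusive) to \<open>1\<close>, the possible positive values \<open>q l * p powi k\<close> of the
  deformed norm, read in increasing order, run through \<open>q 0, \<dots>, q (d - 1)\<close> at level \<open>k\<close> and then
  go on with \<open>q 0\<close> at level \<open>k + 1\<close>: they form a single strictly increasing sequence indexed by the
  integers \<open>m = k d + l\<close> (lemma \<open>critical_radius_less\<close>). Hence the balls of positive radius around
  zero are boxes that also form a chain indexed by the integers (\<open>deformed_ball_eq_padic_box\<close> and
  \<open>padic_box_subset_iff\<close>), in which the maximal proper subball of a box is its predecessor.

  In the \<open>m\<close>-th box the coordinate \<open>l\<close> is bounded by \<open>p\<close> to the power \<open>(m - l) div d\<close>. Moving the
  coordinate \<open>l + 1\<close> to the position \<open>l\<close> turns this bound into the one for the index \<open>m - 1\<close>, and so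
  does moving the coordinate \<open>0\<close> to the position \<open>d - 1\<close> while multiplying it by \<open>p\<close>, because
  \<open>(m - 1 - (d - 1)) div d = m div d - 1\<close>. So the matrix maps each box onto its predecessor
  (\<open>shift_mat_image_padic_box\<close>). An arbitrary competitor for maximality need not be centered at
  zero, but it contains zero, and in an ultrametric every point of a ball is a center of it.
\<close>

section \<open>Comparing powers and quotients\<close>

lemma power_int_le_power_int_iff:
  fixes x :: "'a::linordered_field"
  assumes "x > 1"
  shows "x powi m \<le> x powi n \<longleftrightarrow> m \<le> n"
  using assms power_int_strict_increasing[of n m x] power_int_increasing[of m n x]
  by (auto simp flip: not_less)

lemma le_zdiv_iff_mult_le:
  fixes a b c :: int
  assumes "c > 0"
  shows "a \<le> b div c \<longleftrightarrow> a * c \<le> b"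
proof
  assume "a \<le> b div c"
  hence "a * c \<le> b div c * c" using assms by simp
  also have "\<dots> \<le> b" using assms div_mult_mod_eq[of b c] pos_mod_sign[of c b] by linarith
  finally show "a * c \<le> b" .
next
  assume "a * c \<le> b"
  thus "a \<le> b div c" using assms zdiv_mono1[of "a * c" b c] by simp
qed


section \<open>Values of the p-adic absolute value\<close>

lemma padic_abs_0 [simp]: "padic_abs 0 = 0"
  by (simp add: padic_abs_eq_0_iff)

lemma padic_abs_minus: "padic_abs (- x) = padic_abs x"
  using padic_abs_minus_commute[of 0 x] by simp

lemma padic_abs_1 [simp]: "padic_abs 1 = 1"
proof -
  have "padic_abs (1 :: 'a padic) * padic_abs (1 :: 'a padic) = padic_abs (1 :: 'a padic)"
    by (simp flip: padic_abs_mult)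
  moreover have "padic_abs (1 :: 'a padic) \<noteq> 0" by (simp add: padic_abs_eq_0_iff)
  ultimately show ?thesis by simp
qed

lemma padic_abs_inverse: "padic_abs (inverse x) = inverse (padic_abs x)"
proof (cases "x = 0")
  case False
  have "padic_abs x * padic_abs (inverse x) = 1"
    using False by (simp flip: padic_abs_mult)
  thus ?thesis by (metis inverse_unique)
qed simp

lemma padic_abs_power: "padic_abs (x ^ n) = padic_abs x ^ n"
  by (induction n) (simp_all add: padic_abs_mult)

lemma padic_abs_power_int: "padic_abs (x powi k) = padic_abs x powi k"
  by (cases "k \<ge> 0") (simp_all add: power_int_def padic_abs_power padic_abs_inverse)

lemma of_nat_CARD_neq_0: "(of_nat CARD('p) :: 'p::prime_card padic) \<noteq> 0"
proof -
  have "padic_abs (of_nat CARD('p) :: 'p padic) \<noteq> 0"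
    using prime_gt_0_nat[OF prime_card[where 'a = 'p]] by (simp add: padic_abs_of_nat_prime)
  thus ?thesis by (simp only: padic_abs_eq_0_iff not_False_eq_True)
qed

lemma ex_padic_abs_eq_power_int: "\<exists>x :: 'p::prime_card padic. padic_abs x = real CARD('p) powi k"
proof
  show "padic_abs (inverse (of_nat CARD('p)) powi k :: 'p padic) = real CARD('p) powi k"
    by (simp only: padic_abs_power_int padic_abs_inverse padic_abs_of_nat_prime) simp
qed

text \<open>
  A positive limit of powers of \<open>p\<close> is a power of \<open>p\<close>: after taking logarithms to the base \<open>p\<close> this
  is the closedness of the set of integers. Completing the rationals thus creates no new values.
\<close>

lemma padic_abs_eq_power_int:
  fixes x :: "'p::prime_card padic"
  assumes "x \<noteq> 0"
  obtains k where "padic_abs x = real CARD('p) powi k"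
proof -
  let ?p = "real CARD('p)"
  have prime: "prime CARD('p)" by (rule prime_card)
  hence p: "?p > 1" using prime_gt_1_nat[OF prime] by simp
  have "\<exists>k. padic_abs x = ?p powi k"
    using assms
  proof (transfer, goal_cases)
    case (1 X)
    let ?L = "lim (\<lambda>n. rat_padic_abs CARD('p) (X n))"
    have X: "padic_Cauchy CARD('p) X" and nn: "\<not> padic_null CARD('p) X"
      using 1 by (simp_all add: padic_rel_def)
    have lim: "(\<lambda>n. rat_padic_abs CARD('p) (X n)) \<longlonglongrightarrow> ?L"
      by (rule rat_padic_abs_LIMSEQ[OF prime X])
    obtain b N where b: "b > 0" "\<And>n. n \<ge> N \<Longrightarrow> rat_padic_abs CARD('p) (X n) > b"
      using padic_not_null_bound[OF prime X nn] by metis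
    have "?L \<ge> b"
      using b(2) by (intro LIMSEQ_le_const[OF lim]) (auto intro: less_imp_le)
    hence L: "?L > 0" using b(1) by linarith
    have "(\<lambda>n. log ?p (rat_padic_abs CARD('p) (X n))) \<longlonglongrightarrow> log ?p ?L"
      using p L by (intro tendsto_log tendsto_const lim) auto
    moreover have "\<forall>\<^sub>F n in sequentially. log ?p (rat_padic_abs CARD('p) (X n)) \<in> \<int>"
      unfolding eventually_sequentially
    proof (intro exI allI impI)
      fix n assume "n \<ge> N"
      hence "X n \<noteq> 0" using b(2)[of n] b(1) by auto
      then obtain k where "rat_padic_abs CARD('p) (X n) = ?p powi k"
        by (cases "quotient_of (X n)") (auto simp: rat_padic_abs_def)
      moreover have "log ?p (?p powi k) = of_int k"
        using p by (simp flip: powr_real_of_int')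
      ultimately show "log ?p (rat_padic_abs CARD('p) (X n)) \<in> \<int>" by simp
    qed
    ultimately have "log ?p ?L \<in> \<int>"
      by (intro Lim_in_closed_set[OF closed_Ints]) auto
    then obtain k where k: "log ?p ?L = of_int k" by (elim Ints_cases)
    have "?L = ?p powr (of_int k)" using p L by (simp flip: k)
    also have "\<dots> = ?p powi k" using p by (intro powr_real_of_int') auto
    finally show ?case by blast
  qed
  thus ?thesis using that by blast
qed


section \<open>Balls of the deformed metric\<close>

lemma deformed_dist_le_iff:
  "d > 0 \<Longrightarrow> deformed_dist d q x y \<le> r \<longleftrightarrow> (\<forall>l<d. q l * padic_abs (x $ l - y $ l) \<le> r)"
  unfolding deformed_dist_def by (subst Max_le_iff) auto

lemma in_deformed_ball_iff:
  assumes "d > 0" "\<And>l. l < d \<Longrightarrow> q l > 0"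
  shows "y \<in> deformed_ball d q x r \<longleftrightarrow>
    x \<in> carrier_vec d \<and> y \<in> carrier_vec d \<and> (\<forall>l<d. q l * padic_abs (x $ l - y $ l) \<le> r)"
  by (simp add: Metric_space.in_mcball[OF Metric_space_deformed_dist] assms deformed_dist_le_iff)

lemma deformed_ball_recenter:
  assumes d: "d > 0" and q: "\<And>l. l < d \<Longrightarrow> q l > 0" and y: "y \<in> deformed_ball d q x r"
  shows "deformed_ball d q x r = deformed_ball d q y r"
proof -
  have le: "q l * padic_abs (u - w) \<le> r"
    if "l < d" "q l * padic_abs (u - v) \<le> r" "q l * padic_abs (v - w) \<le> r"
    for l and u v w :: "'a padic"
  proof -
    have "padic_abs (u - w) \<le> max (padic_abs (u - v)) (padic_abs (v - w))"
      using padic_abs_add[of "u - v" "v - w"] by simp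
    hence "q l * padic_abs (u - w) \<le> q l * max (padic_abs (u - v)) (padic_abs (v - w))"
      using q[OF that(1)] by simp
    also have "\<dots> \<le> r" using that by (simp add: max_def)
    finally show ?thesis .
  qed
  show ?thesis
  proof (intro Set.set_eqI iffI)
    fix z assume "z \<in> deformed_ball d q x r"
    moreover from this y have "q l * padic_abs (y $ l - z $ l) \<le> r" if "l < d" for l
      using that
      by (auto simp: in_deformed_ball_iff d q padic_abs_minus_commute[of "y $ l" "x $ l"]
          intro: le[OF that, where v = "x $ l"])
    ultimately show "z \<in> deformed_ball d q y r"
      using y by (simp add: in_deformed_ball_iff d q)
  next
    fix z assume "z \<in> deformed_ball d q y r"
    with y show "z \<in> deformed_ball d q x r"
      by (auto simp: in_deformed_ball_iff d q intro: le[where v = "y $ _"])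
  qed
qed


section \<open>The chain of balls around zero\<close>

text \<open>
  The positive values of the deformed norm, enumerated by writing \<open>m = k d + l\<close> with \<open>0 \<le> l < d\<close>.
\<close>

definition critical_radius :: "nat \<Rightarrow> (nat \<Rightarrow> real) \<Rightarrow> real \<Rightarrow> int \<Rightarrow> real" where
  "critical_radius d q p m = q (nat (m mod int d)) * p powi (m div int d)"

text \<open>
  Within one level the enumeration increases with \<open>q\<close>; from one level to the next the factor \<open>p\<close>
  outweighs any quotient of two of the parameters.
\<close>

lemma critical_radius_less:
  assumes d: "d > 0" and mono: "strict_mono_on {..<d} q"
    and q: "\<And>l. l < d \<Longrightarrow> q l \<in> {1 / p <.. 1}" and p: "p > 1" and "m < n"
  shows "critical_radius d q p m < critical_radius d q p n"
proof -
  let ?l = "\<lambda>m. nat (m mod int d)"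
  have l: "?l m < d" for m using d by (simp add: nat_less_iff)
  have "m div int d \<le> n div int d" using \<open>m < n\<close> d by (intro zdiv_mono1) auto
  then consider "m div int d = n div int d" | "m div int d + 1 \<le> n div int d" by linarith
  thus ?thesis
  proof cases
    case 1
    hence "m div int d * int d = n div int d * int d" by simp
    hence "m mod int d < n mod int d"
      using \<open>m < n\<close> div_mult_mod_eq[of m "int d"] div_mult_mod_eq[of n "int d"] by linarith
    hence "?l m < ?l n" using d pos_mod_sign[of "int d" m] by linarith
    hence "q (?l m) < q (?l n)" using mono l by (auto simp: strict_mono_on_def)
    thus ?thesis using 1 p by (simp add: critical_radius_def)
  next
    case 2
    have pos: "q (?l n) > 0"
      using q[OF l[of n]] p by (auto intro: order.strict_trans[of 0 "1 / p"])
    have "critical_radius d q p m \<le> 1 * p powi (m div int d)"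
      unfolding critical_radius_def using q[OF l[of m]] p by (intro mult_right_mono) auto
    also have "\<dots> = (1 / p) * p powi (m div int d + 1)"
      using p by (simp add: power_int_add)
    also have "\<dots> < q (?l n) * p powi (m div int d + 1)"
      using q[OF l[of n]] p by (intro mult_strict_right_mono) auto
    also have "\<dots> \<le> critical_radius d q p n"
      unfolding critical_radius_def using pos p 2
      by (intro mult_left_mono power_int_increasing) auto
    finally show ?thesis .
  qed
qed

lemma critical_radius_le_iff:
  assumes "d > 0" "strict_mono_on {..<d} q" "\<And>l. l < d \<Longrightarrow> q l \<in> {1 / p <.. 1}" "p > 1"
  shows "critical_radius d q p m \<le> critical_radius d q p n \<longleftrightarrow> m \<le> n"
  using critical_radius_less[OF assms, of m n] critical_radius_less[OF assms, of n m]
  by (cases m n rule: linorder_cases) auto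

lemma ex_critical_radius_between:
  assumes d: "d > 0" and mono: "strict_mono_on {..<d} q"
    and q: "\<And>l. l < d \<Longrightarrow> q l \<in> {1 / p <.. 1}" and p: "p > 1" and r: "r > 0"
  obtains m where "critical_radius d q p m \<le> r" "r < critical_radius d q p (m + 1)"
proof -
  let ?R = "critical_radius d q p"
  have le_iff: "?R m \<le> ?R n \<longleftrightarrow> m \<le> n" for m n
    by (rule critical_radius_le_iff[OF d mono q p])
  have R: "?R (int d * k) = q 0 * p powi k" for k
    using d by (simp add: critical_radius_def)
  have q0: "q 0 > 0" using q[OF d] p by (auto intro: order.strict_trans[of 0 "1 / p"])
  obtain i where "r / q 0 < p ^ i" using real_arch_pow[OF p] by blast
  hence upper: "r < ?R (int d * int i)" unfolding R using q0 by (simp add: field_simps)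
  obtain j where "q 0 / r < p ^ j" using real_arch_pow[OF p] by blast
  hence lower: "?R (int d * - int j) \<le> r"
    unfolding R using q0 r p by (simp add: power_int_minus field_simps)
  define S where "S = {m. int d * - int j \<le> m \<and> ?R m \<le> r}"
  have "m \<le> int d * int i" if "?R m \<le> r" for m
    using that upper by (simp flip: le_iff)
  hence "S \<subseteq> {int d * - int j..int d * int i}" by (auto simp: S_def)
  hence fin: "finite S" by (rule finite_subset) simp
  have "S \<noteq> {}" using lower by (auto simp: S_def)
  hence max: "Max S \<in> S" using fin by (rule Max_in[rotated])
  have "\<not> ?R (Max S + 1) \<le> r"
  proof
    assume "?R (Max S + 1) \<le> r"
    hence "Max S + 1 \<in> S" using max by (simp add: S_def)
    hence "Max S + 1 \<le> Max S" using fin by (intro Max_ge)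
    thus False by simp
  qed
  thus ?thesis using that[of "Max S"] max by (simp add: S_def)
qed

definition padic_box :: "nat \<Rightarrow> int \<Rightarrow> 'p::prime_card padic vec set" where
  "padic_box d m =
     {x \<in> carrier_vec d. \<forall>l<d. padic_abs (x $ l) \<le> real CARD('p) powi ((m - int l) div int d)}"

text \<open>
  For a coordinate of absolute value \<open>p powi k\<close>, the weighted value \<open>q l * p powi k\<close> is the critical
  radius of index \<open>k d + l\<close>. It is at most \<open>r\<close> iff \<open>k d + l \<le> m\<close>, that is, \<open>k \<le> (m - l) div d\<close>.
\<close>

lemma deformed_ball_eq_padic_box:
  assumes d: "d > 0" and mono: "strict_mono_on {..<d} q"
    and q: "\<And>l. l < d \<Longrightarrow> q l \<in> {1 / real CARD('p::prime_card) <.. 1}"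
    and m: "critical_radius d q (real CARD('p)) m \<le> r"
           "r < critical_radius d q (real CARD('p)) (m + 1)"
  shows "deformed_ball d q (0\<^sub>v d) r = (padic_box d m :: 'p padic vec set)"
proof -
  let ?p = "real CARD('p)"
  let ?R = "critical_radius d q ?p"
  have p: "?p > 1" using prime_gt_1_nat[OF prime_card[where 'a = 'p]] by simp
  have q0: "q l > 0" if "l < d" for l
    using q[OF that] p by (auto intro: order.strict_trans[of 0 "1 / ?p"])
  have r: "?R n \<le> r \<longleftrightarrow> n \<le> m" for n
  proof
    assume "?R n \<le> r"
    hence "\<not> ?R (m + 1) \<le> ?R n" using m by linarith
    thus "n \<le> m" by (simp add: critical_radius_le_iff[OF d mono q p])
  next
    assume "n \<le> m"
    hence "?R n \<le> ?R m" by (simp add: critical_radius_le_iff[OF d mono q p])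
    thus "?R n \<le> r" using m by linarith
  qed
  have coord: "q l * padic_abs x \<le> r \<longleftrightarrow> padic_abs x \<le> ?p powi ((m - int l) div int d)"
    if l: "l < d" for l and x :: "'p padic"
  proof (cases "x = 0")
    case True
    have "0 \<le> ?R m" using q0[of "nat (m mod int d)"] d by (simp add: critical_radius_def nat_less_iff)
    thus ?thesis using True m(1) by simp
  next
    case False
    then obtain k where k: "padic_abs x = ?p powi k" by (rule padic_abs_eq_power_int)
    have "q l * padic_abs x = ?R (int d * k + int l)"
      using l by (simp add: k critical_radius_def)
    hence "q l * padic_abs x \<le> r \<longleftrightarrow> k * int d \<le> m - int l"
      by (simp add: r algebra_simps)
    also have "\<dots> \<longleftrightarrow> k \<le> (m - int l) div int d"
      using d by (simp add: le_zdiv_iff_mult_le)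
    also have "\<dots> \<longleftrightarrow> padic_abs x \<le> ?p powi ((m - int l) div int d)"
      unfolding k using p by (simp add: power_int_le_power_int_iff)
    finally show ?thesis .
  qed
  show ?thesis
    by (rule Set.set_eqI)
      (auto simp: in_deformed_ball_iff[OF d q0] padic_box_def coord padic_abs_minus)
qed

text \<open>
  Raising the index from \<open>m - 1\<close> to \<open>m\<close> relaxes exactly one bound, that of the coordinate
  \<open>m mod d\<close>. A vector whose only nonzero coordinate is this one, with the largest absolute value
  that the \<open>m\<close>-th box allows, therefore lies outside all boxes of smaller index.
\<close>

lemma padic_box_subset_iff:
  assumes d: "d > 0"
  shows "padic_box d m \<subseteq> (padic_box d n :: 'p::prime_card padic vec set) \<longleftrightarrow> m \<le> n"
proof
  let ?p = "real CARD('p)"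
  have p: "?p > 1" using prime_gt_1_nat[OF prime_card[where 'a = 'p]] by simp
  show "padic_box d m \<subseteq> (padic_box d n :: 'p padic vec set)" if "m \<le> n"
  proof -
    have "?p powi ((m - int l) div int d) \<le> ?p powi ((n - int l) div int d)" for l
      using that d p by (intro power_int_increasing zdiv_mono1) auto
    thus ?thesis unfolding padic_box_def by (blast intro: order_trans)
  qed
  assume sub: "padic_box d m \<subseteq> (padic_box d n :: 'p padic vec set)"
  show "m \<le> n"
  proof (rule ccontr)
    assume "\<not> m \<le> n"
    define i where "i = nat (m mod int d)"
    have i: "i < d" "int i = m mod int d" using d by (simp_all add: i_def nat_less_iff)
    have m: "m - int i = m div int d * int d"
      using div_mult_mod_eq[of m "int d"] i(2) by linarith
    obtain x :: "'p padic" where x: "padic_abs x = ?p powi (m div int d)"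
      using ex_padic_abs_eq_power_int by blast
    let ?v = "vec d (\<lambda>l. if l = i then x else 0)"
    have "?v \<in> padic_box d m"
      using d p by (auto simp: padic_box_def x m)
    hence "?v \<in> padic_box d n" using sub by blast
    hence "?p powi (m div int d) \<le> ?p powi ((n - int i) div int d)"
      using i(1) by (auto simp: padic_box_def simp flip: x)
    hence "m div int d \<le> (n - int i) div int d" using p by (simp add: power_int_le_power_int_iff)
    hence "m div int d * int d \<le> n - int i" using d by (simp add: le_zdiv_iff_mult_le)
    thus False using \<open>\<not> m \<le> n\<close> m by linarith
  qed
qed


section \<open>The shift is a dilation\<close>

lemma shift_mat_image_padic_box:
  assumes d: "d \<ge> 2"
  shows "(*\<^sub>v) (shift_mat d) ` padic_box d m = (padic_box d (m - 1) :: 'p::prime_card padic vec set)"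
proof
  let ?p = "real CARD('p)"
  let ?c = "of_nat CARD('p) :: 'p padic"
  have p: "?p > 1" using prime_gt_1_nat[OF prime_card[where 'a = 'p]] by simp
  have wrap: "(m - 1 - int (d - 1)) div int d = m div int d - 1"
  proof -
    have "m - 1 - int (d - 1) = m + (- 1) * int d" using d by simp
    thus ?thesis using d by (simp only: div_mult_self1)
  qed
  have last: "i = d - 1" if "i < d" "\<not> i < d - 1" for i using that by linarith
  show "(*\<^sub>v) (shift_mat d) ` padic_box d m \<subseteq> (padic_box d (m - 1) :: 'p padic vec set)"
  proof safe
    fix x :: "'p padic vec" assume x: "x \<in> padic_box d m"
    hence xd: "x \<in> carrier_vec d" by (simp add: padic_box_def)
    have bound: "padic_abs (x $ l) \<le> ?p powi ((m - int l) div int d)" if "l < d" for l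
      using x that by (simp add: padic_box_def)
    have "padic_abs ((shift_mat d *\<^sub>v x) $ i) \<le> ?p powi ((m - 1 - int i) div int d)"
      if i: "i < d" for i
    proof (cases "i < d - 1")
      case True
      thus ?thesis using bound[of "i + 1"] i by (simp add: shift_mat_mult_vec[OF d xd] algebra_simps)
    next
      case False
      have "padic_abs (?c * x $ 0) \<le> ?p powi (m div int d - 1)"
        using bound[of 0] d p
        by (simp add: padic_abs_mult padic_abs_of_nat_prime power_int_diff divide_right_mono)
      thus ?thesis
        using d unfolding last[OF i False] wrap by (simp add: shift_mat_mult_vec[OF d xd])
    qed
    thus "shift_mat d *\<^sub>v x \<in> padic_box d (m - 1)"
      using d by (simp add: padic_box_def shift_mat_mult_vec[OF d xd])
  qed
  show "padic_box d (m - 1) \<subseteq> (*\<^sub>v) (shift_mat d) ` (padic_box d m :: 'p padic vec set)"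
  proof
    fix y :: "'p padic vec" assume y: "y \<in> padic_box d (m - 1)"
    hence yd: "y \<in> carrier_vec d" by (simp add: padic_box_def)
    have bound: "padic_abs (y $ l) \<le> ?p powi ((m - 1 - int l) div int d)" if "l < d" for l
      using y that by (simp add: padic_box_def)
    define x where "x = vec d (\<lambda>l. if l = 0 then inverse ?c * y $ (d - 1) else y $ (l - 1))"
    have xd: "x \<in> carrier_vec d" by (simp add: x_def)
    have "padic_abs (x $ l) \<le> ?p powi ((m - int l) div int d)" if l: "l < d" for l
    proof (cases "l = 0")
      case True
      have "padic_abs (y $ (d - 1)) \<le> ?p powi (m div int d - 1)"
        using bound[of "d - 1"] d unfolding wrap by simp
      hence "?p * padic_abs (y $ (d - 1)) \<le> ?p powi (m div int d)"
        using p by (simp add: power_int_diff field_simps)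
      moreover have "padic_abs (x $ l) = ?p * padic_abs (y $ (d - 1))"
        using True d by (simp add: x_def padic_abs_mult padic_abs_inverse padic_abs_of_nat_prime)
      ultimately show ?thesis using True by simp
    next
      case False
      hence "m - 1 - int (l - 1) = m - int l" by simp
      thus ?thesis using False bound[of "l - 1"] l by (simp add: x_def)
    qed
    hence "x \<in> padic_box d m" using xd by (simp add: padic_box_def)
    moreover have "y = shift_mat d *\<^sub>v x"
      unfolding shift_mat_mult_vec[OF d xd]
    proof (rule eq_vecI)
      fix i assume "i < dim_vec (vec d (\<lambda>i. if i < d - 1 then x $ (i + 1) else ?c * x $ 0))"
      hence i: "i < d" by simp
      thus "y $ i = vec d (\<lambda>i. if i < d - 1 then x $ (i + 1) else ?c * x $ 0) $ i"
        using last[OF i] d of_nat_CARD_neq_0[where 'p = 'p] by (auto simp: x_def)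
    qed (use yd in simp)
    ultimately show "y \<in> (*\<^sub>v) (shift_mat d) ` padic_box d m" by blast
  qed
qed

lemma linear_map_mult_mat_vec:
  fixes A :: "'a::field mat"
  assumes A: "A \<in> carrier_mat n m"
  shows "linear_map class_ring (module_vec TYPE('a) m) (module_vec TYPE('a) n) ((*\<^sub>v) A)"
proof -
  have "(*\<^sub>v) A \<in> module_hom class_ring (module_vec TYPE('a) m) (module_vec TYPE('a) n)"
    using A by (auto simp: module_hom_def module_vec_simps mult_add_distrib_mat_vec mult_mat_vec)
  thus ?thesis
    by (intro linear_map.intro mod_hom.intro vec_vs vec_module mod_hom_axioms.intro)
qed

theorem lemma6:
  fixes d :: nat and q :: "nat \<Rightarrow> real"
  assumes "d \<ge> 2"
    and "strict_mono_on {..<d} q"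
    and "\<And>l. l < d \<Longrightarrow> q l \<in> {1 / real CARD('p::prime_card) <.. 1}"
  shows "is_dilation d q ((*\<^sub>v) (shift_mat d :: 'p padic mat))"
proof -
  let ?p = "real CARD('p)"
  let ?R = "critical_radius d q ?p"
  let ?A = "(*\<^sub>v) (shift_mat d :: 'p padic mat)"
  let ?ball = "deformed_ball d q (0\<^sub>v d) :: real \<Rightarrow> 'p padic vec set"
  let ?box = "padic_box d :: int \<Rightarrow> 'p padic vec set"
  have d: "d > 0" using assms(1) by simp
  have p: "?p > 1" using prime_gt_1_nat[OF prime_card[where 'a = 'p]] by simp
  have q: "q l > 0" if "l < d" for l
    using assms(3)[OF that] p by (auto intro: order.strict_trans[of 0 "1 / ?p"])
  have box_radius: "?box m = ?ball (?R m)" for m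
    using critical_radius_less[OF d assms(2,3) p]
    by (intro deformed_ball_eq_padic_box[OF d assms(2,3), symmetric]) auto
  have R_nonneg: "?R m \<ge> 0" for m
    using q[of "nat (m mod int d)"] d by (simp add: critical_radius_def nat_less_iff)
  have ball_box: "\<exists>m. ?ball r = ?box m" if "r > 0" for r
    using ex_critical_radius_between[OF d assms(2,3) p that]
      deformed_ball_eq_padic_box[OF d assms(2,3)] by metis
  have box_ball: "is_deformed_ball d q (?box m)" for m
    unfolding is_deformed_ball_def box_radius using R_nonneg by (intro bexI exI conjI) auto
  have maximal: "maximal_proper_subball d q (?box m) (?box (m - 1))" for m
    unfolding maximal_proper_subball_def
  proof (intro conjI notI)
    show "?box (m - 1) \<subset> ?box m" unfolding less_le_not_le padic_box_subset_iff[OF d] by simp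
    assume "\<exists>D. is_deformed_ball d q D \<and> ?box (m - 1) \<subset> D \<and> D \<subset> ?box m"
    then obtain c s where s: "s \<ge> 0"
      and D: "?box (m - 1) \<subset> deformed_ball d q c s" "deformed_ball d q c s \<subset> ?box m"
      unfolding is_deformed_ball_def by blast
    have "0\<^sub>v d \<in> ?box (m - 1)" using p by (simp add: padic_box_def)
    hence "deformed_ball d q c s = ?ball s"
      using D(1) by (intro deformed_ball_recenter[OF d q]) auto
    \<comment> \<open>The ball of radius zero lies in every box, so it cannot contain a box properly.\<close>
    moreover have "s \<noteq> 0"
    proof
      assume "s = 0"
      have "?ball 0 \<subseteq> ?box (m - 2)"
        unfolding box_radius using R_nonneg[of "m - 2"]
        by (intro Metric_space.mcball_subset_concentric[OF Metric_space_deformed_dist] d q)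
      hence "?box (m - 1) \<subseteq> ?box (m - 2)"
        using D(1) \<open>deformed_ball d q c s = ?ball s\<close> \<open>s = 0\<close> by auto
      thus False by (simp add: padic_box_subset_iff[OF d])
    qed
    ultimately obtain n where n: "deformed_ball d q c s = ?box n" using ball_box[of s] s by auto
    show False
      using D unfolding n less_le_not_le padic_box_subset_iff[OF d] by linarith
  qed (rule box_ball)
  show ?thesis
    unfolding is_dilation_def
  proof (intro conjI allI impI)
    show "linear_map class_ring (module_vec TYPE('p padic) d) (module_vec TYPE('p padic) d) ?A"
      by (intro linear_map_mult_mat_vec) (simp add: shift_mat_def)
    fix r :: real assume "r > 0"
    then obtain m where m: "?ball r = ?box m" using ball_box by blast
    have image: "?A ` ?ball r = ?box (m - 1)" unfolding m by (rule shift_mat_image_padic_box[OF assms(1)])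
    show "maximal_proper_subball d q (?ball r) (?A ` ?ball r)"
      unfolding image unfolding m by (rule maximal)
    show "\<exists>s\<ge>0. ?A ` ?ball r = ?ball s"
      unfolding image box_radius using R_nonneg by blast
  qed
qed

end
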